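(* Brickell and Li's pairing-based DAA scheme, with the minor modification that the hash challenge in the join protocol no longer includes the issuer public key $\mathit{pk}_I$, is an updateable DAA scheme.
   Context: **DAA schemes.** A direct anonymous attestation scheme has algorithms $\mathsf{Setup}_{\mathsf{DAA}}(1^\lambda)\to(\mathit{pk}_I,\mathit{sk}_I)$, $\mathsf{Sign}_{\mathsf{DAA}}(\mathit{sk}_S,\mathit{cred}_S,\mathit{dom},m)$, $\mathsf{Verify}_{\mathsf{DAA}}(\mathit{pk}_I,m,\mathit{dom},\sigma,RL)$ ($RL$ a list of revoked secret keys), $\mathsf{Link}_{\mathsf{DAA}}$ and a protocol $\mathsf{Join\text{-}Issue}_{\mathsf{DAA}}$ by which the issuer gives a signer with secret key $\mathit{sk}_S$ a credential $\mathit{cred}_S$. **Updateable.** A DAA scheme is updateable if: 1. $\mathsf{Setup}_{\mathsf{DAA}}$ can be divided into $\mathsf{Setup}_1$ and $\mathsf{Setup}_2$ such that $\mathsf{Setup}_1(1^\lambda)$ outputs a persistent group public key $\mathit{gpk}_1$, and $\mathsf{Setup}_2(1^\lambda,\mathit{gpk}_1)$ outputs an ephemeral group public key $\mathit{gpk}_2$ and the secret key $\mathit{sk}_I$, where $\mathit{pk}_I=(\mathit{gpk}_1,\mathit{gpk}_2)$. 2. $\mathsf{Join\text{-}Issue}_{\mathsf{DAA}}$ consists of two steps $\mathsf{User}_{\mathsf{DAA}}$ and $\mathsf{Issuer}_{\mathsf{DAA}}$ such that $\mathsf{User}_{\mathsf{DAA}}(\mathit{gpk}_1,\mathit{sk}_S)$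 outputs an update message $u$, and $\mathsf{Issuer}_{\mathsf{DAA}}$, on input $\mathit{pk}_I$, $u$ and $\mathit{sk}_I$, outputs valid credentials $\mathit{cred}_S$ for $\mathit{sk}_S$ w.r.t. the new $\mathit{pk}_I$ (i.e. for any $\mathit{pk}_I$ produced with the same $\mathit{gpk}_1$). 3. $\mathsf{Setup}_1$ uses only public coins to generate $\mathit{gpk}_1$, i.e. no secrets are required to generate $\mathit{gpk}_1$, and giving those coins to the adversary only negligibly increases its advantage in the user-controlled-anonymity and user-controlled-traceability experiments. **The two experiments.** *User-controlled-anonymity:* the adversary gets $\mathit{sk}_I,\mathit{pk}_I$, may ask for signatures Sign$(S,\mathit{dom},m)$, let signers join with the adversary as issuer (the challenger checks the credential's validity and keeps the key secret), and corrupt signers (obtaining their keys); it then picks $S_0,S_1,m,\mathit{dom}$ (with $S_0,S_1$ never corrupted and, if $\mathit{dom}\ne\bot$, never asked to sign w.r.t. $\mathit{dom}$), receives a signature by $S_b$ for a uniform bit $b$, continues under the same restrictions and must guess $b$. *User-controlled-traceability:* the adversary gets $\mathit{pk}_I$, may query Sign, Join (either the challenger creates key and credential for $S$ and returns the credential, or the adversary supplies the key, which is put into $RL$, and gets the credential) and Corrupt (the key is returned and put into $RL$); it wins by outputting $(S,\sigma,m,\mathit{dom})$ with $\mathsf{Verify}_{\mathsf{DAA}}(\mathit{pk}_I,m,\mathit{dom},\sigma,RL)=1$ where $\sigma$ is no response to a Sign query, and/or, for $\mathit{dom}\ne\bot$, such that another signature $\sigma'$ associated with the same identity and $\mathit{dom}$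 has $\mathsf{Link}_{\mathsf{DAA}}(\sigma,\sigma')=0$. **Brickell and Li's scheme.** Let $\mathbb{G}_1,\mathbb{G}_2,\mathbb{G}_T$ be groups of prime order $q$ with a bilinear pairing $e:\mathbb{G}_1\times\mathbb{G}_2\to\mathbb{G}_T$ and generators $g_1,g_2$; $\mathbb{G}$ a group of order $q$; $H$ a hash function into $\mathbb{Z}_q$; $h:\{0,1\}^*\to\mathbb{G}$ the basename hash. In setup, $h_1\in\mathbb{G}_1$ is sampled directly as a random group element, as is $h_2\in\mathbb{G}_1$; the issuer picks a secret $\gamma\in\mathbb{Z}_q^*$, $\mathit{sk}_I=\gamma$, and sets $w=g_2^\gamma$, $T_1=e(g_1,g_2)$, $T_2=e(h_1,g_2)$, $T_3=e(h_2,g_2)$, $T_4=e(h_2,w)$; these (except $\gamma$) with the group description form $\mathit{pk}_I$. - *Join/issue:* a signer with key $\mathit{sk}_S=f\in\mathbb{Z}_q^*$ computes, for a nonce $\mathsf{nonce}$ (sent by the issuer against replay), $F=h_1^f$, $R=h_1^{r_f}$ for random $r_f$, a challenge $c=H(\mathit{pk}_I\|\mathsf{nonce}\|F\|R)$ and $s_f=r_f+cf$, and sends $(F,c,s_f,\mathsf{nonce})$. The issuer verifies this Schnorr-type proof, picks $x\in\mathbb{Z}_q$ and returns $\mathit{cred}_S=(A,x)$ with $A=(g_1F)^{1/(\gamma+x)}$, which is valid iff $e(A,w g_2^x)=e(g_1h_1^f,g_2)$. - *Sign:* $J=h(\mathit{dom})$ (random in $\mathbb{G}$ if $\mathit{dom}=\bot$),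 $K=J^f$; pick $a\in\mathbb{Z}_q$, $b=ax$, $T=A\,h_2^a$; pick $r_f,r_x,r_a,r_b\in\mathbb{Z}_q$, $R_1=J^{r_f}$, $R_2=e(T,g_2)^{-r_x}T_2^{r_f}T_3^{r_b}T_4^{r_a}$; with a random nonce $n$ compute a hash challenge $c$ from $(\mathit{pk}_I,J,K,T,R_1,R_2)$, $n$ and $m$; $s_y=r_y+cy$ for $y\in\{f,x,a,b\}$; $\sigma=(J,K,T,c,n,s_f,s_x,s_a,s_b)$. - *Verify:* check membership of the components, $J=h(\mathit{dom})$ if $\mathit{dom}\neq\bot$, $K\neq J^{f'}$ for all $f'\in RL$, and the challenge recomputed from $J^{s_f}K^{-c}$ and $e(T,g_2^{-s_x}w^{-c})\,T_1^{c}T_2^{s_f}T_3^{s_b}T_4^{s_a}$. - *Link:* compare the pseudonyms $K$ of two valid signatures. **The modification.** In the join protocol the challenge is computed from the remaining values only, $c=H(\mathsf{nonce}\|F\|R)$, i.e. without $\mathit{pk}_I$; everything else is unchanged. The persistent part is $\mathit{gpk}_1=h_1$ together with the group description, $\mathit{gpk}_2$ consists of the remaining public parameters, and the update message is $u=(F,c,s_f,\mathsf{nonce})$. *)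

theory Defs
  imports
    "HOL-Probability.Probability_Mass_Function"
    "HOL-Computational_Algebra.Polynomial"
    "HOL-Number_Theory.Modular_Inverse"
    "HOL-Algebra.Generated_Groups"
begin

section \<open>Bit strings and encodings\<close>

datatype bitstring = Bits (unbits: "bool list")

text \<open>Every object is transmitted and hashed as a tuple of strings. The class axiom says that
  encodings are uniquely parseable prefixes; in particular \<^term>\<open>enc\<close> is injective.\<close>

class wire =
  fixes enc :: "'a \<Rightarrow> bool list list"
    and dec :: "bool list list \<Rightarrow> ('a \<times> bool list list) option"
  assumes dec_enc: "dec (enc x @ r) = Some (x, r)"

instantiation bitstring :: wire
begin
definition "enc_bitstring (x :: bitstring) = [unbits x]"
definition dec_bitstring :: "bool list list \<Rightarrow> (bitstring \<times> bool list list) option" where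
  "dec_bitstring w = (case w of [] \<Rightarrow> None | b # r \<Rightarrow> Some (Bits b, r))"
instance by standard (simp add: enc_bitstring_def dec_bitstring_def)
end

instantiation bool :: wire
begin
definition "enc_bool (x :: bool) = [[x]]"
definition dec_bool :: "bool list list \<Rightarrow> (bool \<times> bool list list) option" where
  "dec_bool w = (case w of [x] # r \<Rightarrow> Some (x, r) | _ \<Rightarrow> None)"
instance by standard (simp add: enc_bool_def dec_bool_def)
end

definition bit_length :: "nat \<Rightarrow> nat" where
  "bit_length n = (LEAST k. n < 2 ^ k)"

lemma less_bit_length: "n < 2 ^ bit_length n"
  unfolding bit_length_def by (rule LeastI[where k = n]) (rule less_exp)

instantiation nat :: wire
begin
definition "enc_nat (n :: nat) = [map (bit n) [0..<bit_length n]]"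
definition dec_nat :: "bool list list \<Rightarrow> (nat \<times> bool list list) option" where
  "dec_nat w = (case w of [] \<Rightarrow> None | b # r \<Rightarrow> Some (horner_sum of_bool 2 b, r))"
instance
  by standard (simp add: enc_nat_def dec_nat_def horner_sum_bit_eq_take_bit
      take_bit_nat_eq_self less_bit_length)
end

instantiation prod :: (wire, wire) wire
begin
definition "enc_prod (x :: 'a \<times> 'b) = enc (fst x) @ enc (snd x)"
definition dec_prod :: "bool list list \<Rightarrow> (('a \<times> 'b) \<times> bool list list) option" where
  "dec_prod w = (case dec w of None \<Rightarrow> None
     | Some (a, r) \<Rightarrow> (case dec r of None \<Rightarrow> None | Some (b, r') \<Rightarrow> Some ((a, b), r')))"
instance by standard (simp add: enc_prod_def dec_prod_def dec_enc)
end

instantiation option :: (wire) wire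
begin
definition "enc_option (x :: 'a option) =
  (case x of None \<Rightarrow> [[False]] | Some y \<Rightarrow> [True] # enc y)"
definition dec_option :: "bool list list \<Rightarrow> ('a option \<times> bool list list) option" where
  "dec_option w = (case w of [] \<Rightarrow> None
     | t # r \<Rightarrow> if t = [False] then Some (None, r)
        else if t = [True] then map_option (\<lambda>(y, r'). (Some y, r')) (dec r)
        else None)"
instance
  by standard (simp add: enc_option_def dec_option_def dec_enc split: option.split)
end


section \<open>Probabilistic polynomial-time adversaries\<close>

text \<open>An adversary is one program, used for all security parameters, on registers that hold bit
  strings, together with a polynomial that clocks it. The banks \<open>In\<close>, \<open>Coin\<close> and \<open>Ans\<close>
  receive the input, the coins (if they are revealed) and the answer to the last
  query. Each instruction costs one time unit. Apart from answers, the longest string in a register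
  grows by at most one bit per unit, so that unit-cost copying does not exceed probabilistic
  polynomial time.\<close>

datatype reg = In nat | Coin nat | Ans nat | Loc nat

datatype prog =
    Skip
  | Push reg bool
  | Pop reg
  | Copy reg reg
  | Flip reg
  | Emit reg \<comment> \<open>append the content to the outgoing message\<close>
  | Call \<comment> \<open>send the outgoing message as a query\<close>
  | Seq prog prog
  | Cond reg prog prog \<comment> \<open>is the top bit present and set?\<close>
  | While reg prog \<comment> \<open>while the register is nonempty\<close>

type_synonym mem = "reg \<Rightarrow> bool list"

type_synonym 's challenger = "'s \<Rightarrow> bool list list \<Rightarrow> (bool list list \<times> 's) pmf"

definition fetch :: "bool list list \<Rightarrow> nat \<Rightarrow> bool list" where
  "fetch w i = (if i < length w then w ! i else [])"

definition init_mem :: "bool list list \<Rightarrow> bool list list \<Rightarrow> mem" where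
  "init_mem w c = (\<lambda>r. case r of In i \<Rightarrow> fetch w i | Coin i \<Rightarrow> fetch c i | _ \<Rightarrow> [])"

definition store_answer :: "bool list list \<Rightarrow> mem \<Rightarrow> mem" where
  "store_answer a m = (\<lambda>r. case r of Ans i \<Rightarrow> fetch a i | _ \<Rightarrow> m r)"

text \<open>The arguments of \<open>run\<close> are the challenger, the remaining time, the remaining program, the
  memory, the outgoing message and the challenger state. The output is the outgoing message at the
  end, and it is empty if the time runs out.\<close>

fun run :: "'s challenger \<Rightarrow> nat \<Rightarrow> prog list \<Rightarrow> mem \<Rightarrow> bool list list \<Rightarrow> 's \<Rightarrow> (bool list list \<times> 's) pmf"
where
  "run C 0 P m out s = return_pmf ([], s)"
| "run C (Suc t) [] m out s = return_pmf (out, s)"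
| "run C (Suc t) (Skip # P) m out s = run C t P m out s"
| "run C (Suc t) (Push r b # P) m out s = run C t P (m(r := b # m r)) out s"
| "run C (Suc t) (Pop r # P) m out s = run C t P (m(r := tl (m r))) out s"
| "run C (Suc t) (Copy r r' # P) m out s = run C t P (m(r' := m r)) out s"
| "run C (Suc t) (Flip r # P) m out s =
     bind_pmf (pmf_of_set UNIV) (\<lambda>b. run C t P (m(r := b # m r)) out s)"
| "run C (Suc t) (Emit r # P) m out s = run C t P m (out @ [m r]) s"
| "run C (Suc t) (Call # P) m out s =
     bind_pmf (C s out) (\<lambda>(a, s'). run C t P (store_answer a m) [] s')"
| "run C (Suc t) (Seq p p' # P) m out s = run C t (p # p' # P) m out s"
| "run C (Suc t) (Cond r p p' # P) m out s =
     run C t ((if m r \<noteq> [] \<and> hd (m r) then p else p') # P) m out s"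
| "run C (Suc t) (While r p # P) m out s =
     run C t (if m r \<noteq> [] then p # While r p # P else P) m out s"

type_synonym adversary = "prog \<times> nat poly"

definition run_adversary ::
  "adversary \<Rightarrow> nat \<Rightarrow> bool list list \<Rightarrow> bool list list \<Rightarrow> 's challenger \<Rightarrow> 's \<Rightarrow> (bool list list \<times> 's) pmf"
where
  "run_adversary A \<eta> w c C s = run C (poly (snd A) \<eta>) [fst A] (init_mem w c) [] s"

definition unary :: "nat \<Rightarrow> bitstring" where
  "unary \<eta> = Bits (replicate \<eta> True)"

definition negligible :: "(nat \<Rightarrow> real) \<Rightarrow> bool" where
  "negligible \<nu> \<longleftrightarrow> (\<forall>c::nat. \<forall>\<^sub>F \<eta> in sequentially. \<bar>\<nu> \<eta>\<bar> \<le> 1 / real \<eta> ^ c)"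


section \<open>DAA schemes\<close>

type_synonym ident = bitstring
type_synonym basename = "bitstring option" \<comment> \<open>\<^term>\<open>None\<close> stands for the empty basename\<close>
type_synonym message = bitstring

text \<open>The first argument of every algorithm is the security parameter. The join protocol consists of
  a first message of the issuer (\<open>nonce\<close>), the signer's message (\<open>join_signer\<close>) and the issuer's
  reply (\<open>join_issuer\<close>), which is \<^term>\<open>None\<close> if the issuer rejects.\<close>

record ('p1, 'p2, 'ski, 'sk, 'cred, 'n, 'u, 'sig) daa =
  daa_setup :: "nat \<Rightarrow> (('p1 \<times> 'p2) \<times> 'ski) pmf"
  keygen :: "nat \<Rightarrow> 'sk pmf"
  nonce :: "nat \<Rightarrow> 'n pmf"
  join_signer :: "nat \<Rightarrow> 'p1 \<times> 'p2 \<Rightarrow> 'sk \<Rightarrow> 'n \<Rightarrow> 'u pmf"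
  join_issuer :: "nat \<Rightarrow> 'p1 \<times> 'p2 \<Rightarrow> 'u \<Rightarrow> 'ski \<Rightarrow> 'cred option pmf"
  valid_cred :: "nat \<Rightarrow> 'p1 \<times> 'p2 \<Rightarrow> 'sk \<Rightarrow> 'cred \<Rightarrow> bool"
  sign :: "nat \<Rightarrow> 'p1 \<times> 'p2 \<Rightarrow> 'sk \<Rightarrow> 'cred \<Rightarrow> basename \<Rightarrow> message \<Rightarrow> 'sig pmf"
  verify :: "nat \<Rightarrow> 'p1 \<times> 'p2 \<Rightarrow> message \<Rightarrow> basename \<Rightarrow> 'sig \<Rightarrow> 'sk list \<Rightarrow> bool"
  link :: "nat \<Rightarrow> 'sig \<Rightarrow> 'sig \<Rightarrow> bool"

definition join_issue ::
  "('p1, 'p2, 'ski, 'sk, 'cred, 'n, 'u, 'sig) daa \<Rightarrow> nat \<Rightarrow> 'p1 \<times> 'p2 \<Rightarrow> 'ski \<Rightarrow> 'sk \<Rightarrow> 'cred option pmf"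
where
  "join_issue D \<eta> pk ski sk = do {
     n \<leftarrow> nonce D \<eta>;
     u \<leftarrow> join_signer D \<eta> pk sk n;
     join_issuer D \<eta> pk u ski
   }"

text \<open>Both experiments take the distribution of the keys as a parameter. It
  also yields the (encoded) coins that are given to the adversary, or the empty
  list. A query that is malformed or not allowed is answered by the empty tuple.\<close>

type_synonym ('p1, 'p2, 'ski) keydist =
  "nat \<Rightarrow> (bool list list \<times> ('p1 \<times> 'p2) \<times> 'ski) pmf"


subsection \<open>User-controlled anonymity\<close>

record ('sk, 'cred) anon_state =
  an_key :: "ident \<Rightarrow> 'sk option"
  an_cred :: "ident \<Rightarrow> 'cred option"
  an_corrupt :: "ident set"
  an_signed :: "(ident \<times> basename) set"
  an_chal :: "(ident \<times> ident \<times> basename) option"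

text \<open>The adversary joins a signer as issuer by \<open>AJoin\<close>, which delivers its first message and
  is answered by the signer's message, followed by \<open>ACred\<close>, which delivers the credential.\<close>

datatype ('n, 'cred) anon_query =
    AJoin ident 'n
  | ACred ident 'cred
  | ASign ident basename message
  | ACorrupt ident
  | AChallenge ident ident message basename

definition parse_anon :: "bool list list \<Rightarrow> ('n::wire, 'cred::wire) anon_query option" where
  "parse_anon w = (case w of [] \<Rightarrow> None
   | t # r \<Rightarrow>
      if t = [False, False, False] then map_option (\<lambda>((S, n), _). AJoin S n) (dec r)
      else if t = [False, False, True] then map_option (\<lambda>((S, c), _). ACred S c) (dec r)
      else if t = [False, True, False] then map_option (\<lambda>((S, d, m), _). ASign S d m) (dec r)
      else if t = [False, True, True] then map_option (\<lambda>(S, _). ACorrupt S) (dec r)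
      else if t = [True, False, False]
        then map_option (\<lambda>((S0, S1, m, d), _). AChallenge S0 S1 m d) (dec r)
      else None)"

fun answer_anon ::
  "('p1, 'p2, 'ski, 'sk::wire, 'cred, 'n, 'u::wire, 'sig::wire) daa \<Rightarrow> nat \<Rightarrow> 'p1 \<times> 'p2 \<Rightarrow> bool
   \<Rightarrow> ('sk, 'cred) anon_state \<Rightarrow> ('n, 'cred) anon_query
   \<Rightarrow> (bool list list \<times> ('sk, 'cred) anon_state) pmf"
where
  "answer_anon D \<eta> pk b s (AJoin S n) =
    (if an_key s S \<noteq> None then return_pmf ([], s)
     else do {
       sk \<leftarrow> keygen D \<eta>;
       u \<leftarrow> join_signer D \<eta> pk sk n;
       return_pmf (enc u, s\<lparr>an_key := (an_key s)(S := Some sk)\<rparr>)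
     })"
| "answer_anon D \<eta> pk b s (ACred S c) =
    (case an_key s S of
       None \<Rightarrow> return_pmf ([], s)
     | Some sk \<Rightarrow>
         if an_cred s S = None \<and> valid_cred D \<eta> pk sk c
         then return_pmf (enc True, s\<lparr>an_cred := (an_cred s)(S := Some c)\<rparr>)
         else return_pmf ([], s))"
| "answer_anon D \<eta> pk b s (ASign S d m) =
    (case (an_key s S, an_cred s S) of
       (Some sk, Some c) \<Rightarrow>
         if (\<exists>S0 S1. an_chal s = Some (S0, S1, d) \<and> d \<noteq> None \<and> S \<in> {S0, S1})
         then return_pmf ([], s)
         else do {
           \<sigma> \<leftarrow> sign D \<eta> pk sk c d m;
           return_pmf (enc \<sigma>, s\<lparr>an_signed := insert (S, d) (an_signed s)\<rparr>)
         }
     | _ \<Rightarrow> return_pmf ([], s))"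
| "answer_anon D \<eta> pk b s (ACorrupt S) =
    (case an_key s S of
       None \<Rightarrow> return_pmf ([], s)
     | Some sk \<Rightarrow>
         if (\<exists>S0 S1 d. an_chal s = Some (S0, S1, d) \<and> S \<in> {S0, S1})
         then return_pmf ([], s)
         else return_pmf (enc sk, s\<lparr>an_corrupt := insert S (an_corrupt s)\<rparr>))"
| "answer_anon D \<eta> pk b s (AChallenge S0 S1 m d) =
    (let S = (if b then S1 else S0) in
     if an_chal s \<noteq> None
        \<or> (\<exists>S' \<in> {S0, S1}. an_key s S' = None \<or> an_cred s S' = None \<or> S' \<in> an_corrupt s
             \<or> (d \<noteq> None \<and> (S', d) \<in> an_signed s))
     then return_pmf ([], s)
     else do {
       \<sigma> \<leftarrow> sign D \<eta> pk (the (an_key s S)) (the (an_cred s S)) d m;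
       return_pmf (enc \<sigma>, s\<lparr>an_chal := Some (S0, S1, d)\<rparr>)
     })"

definition oracle_anon ::
  "('p1, 'p2, 'ski, 'sk::wire, 'cred::wire, 'n::wire, 'u::wire, 'sig::wire) daa \<Rightarrow> nat
   \<Rightarrow> 'p1 \<times> 'p2 \<Rightarrow> bool \<Rightarrow> ('sk, 'cred) anon_state challenger"
where
  "oracle_anon D \<eta> pk b s w =
    (case parse_anon w of None \<Rightarrow> return_pmf ([], s) | Some x \<Rightarrow> answer_anon D \<eta> pk b s x)"

definition anon_init :: "('sk, 'cred) anon_state" where
  "anon_init = \<lparr>an_key = (\<lambda>_. None), an_cred = (\<lambda>_. None), an_corrupt = {}, an_signed = {},
     an_chal = None\<rparr>"

text \<open>An output that is not a bit counts as the guess \<^term>\<open>False\<close>; otherwise giving up would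
  change the distance of the winning probability from one half.\<close>

definition anon_game ::
  "('p1::wire, 'p2::wire, 'ski::wire, 'sk::wire, 'cred::wire, 'n::wire, 'u::wire, 'sig::wire) daa
   \<Rightarrow> ('p1, 'p2, 'ski) keydist \<Rightarrow> adversary \<Rightarrow> nat \<Rightarrow> bool pmf"
where
  "anon_game D K A \<eta> = do {
     (coins, pk, ski) \<leftarrow> K \<eta>;
     b \<leftarrow> pmf_of_set UNIV;
     (out, _) \<leftarrow> run_adversary A \<eta> (enc (unary \<eta>, ski, pk)) coins (oracle_anon D \<eta> pk b) anon_init;
     return_pmf ((case dec out of Some (b', _) \<Rightarrow> b' | None \<Rightarrow> False) = b)
   }"

definition anon_advantage ::
  "('p1::wire, 'p2::wire, 'ski::wire, 'sk::wire, 'cred::wire, 'n::wire, 'u::wire, 'sig::wire) daa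
   \<Rightarrow> ('p1, 'p2, 'ski) keydist \<Rightarrow> adversary \<Rightarrow> nat \<Rightarrow> real"
where
  "anon_advantage D K A \<eta> = \<bar>2 * pmf (anon_game D K A \<eta>) True - 1\<bar>"


subsection \<open>User-controlled traceability\<close>

record ('sk, 'cred, 'sig) trace_state =
  tr_key :: "ident \<Rightarrow> 'sk option"
  tr_cred :: "ident \<Rightarrow> 'cred option"
  tr_RL :: "'sk list"
  tr_log :: "(ident \<times> basename \<times> message \<times> 'sig) set"

datatype 'sk trace_query =
    TSign ident basename message
  | TJoin ident
  | TJoinWith ident 'sk
  | TCorrupt ident

definition parse_trace :: "bool list list \<Rightarrow> ('sk::wire) trace_query option" where
  "parse_trace w = (case w of [] \<Rightarrow> None
   | t # r \<Rightarrow>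
      if t = [False, False] then map_option (\<lambda>((S, d, m), _). TSign S d m) (dec r)
      else if t = [False, True] then map_option (\<lambda>(S, _). TJoin S) (dec r)
      else if t = [True, False] then map_option (\<lambda>((S, sk), _). TJoinWith S sk) (dec r)
      else if t = [True, True] then map_option (\<lambda>(S, _). TCorrupt S) (dec r)
      else None)"

fun answer_trace ::
  "('p1, 'p2, 'ski, 'sk::wire, 'cred::wire, 'n, 'u, 'sig::wire) daa \<Rightarrow> nat \<Rightarrow> 'p1 \<times> 'p2 \<Rightarrow> 'ski
   \<Rightarrow> ('sk, 'cred, 'sig) trace_state \<Rightarrow> 'sk trace_query
   \<Rightarrow> (bool list list \<times> ('sk, 'cred, 'sig) trace_state) pmf"
where
  "answer_trace D \<eta> pk ski s (TSign S d m) =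
    (case (tr_key s S, tr_cred s S) of
       (Some sk, Some c) \<Rightarrow> do {
         \<sigma> \<leftarrow> sign D \<eta> pk sk c d m;
         return_pmf (enc \<sigma>, s\<lparr>tr_log := insert (S, d, m, \<sigma>) (tr_log s)\<rparr>)
       }
     | _ \<Rightarrow> return_pmf ([], s))"
| "answer_trace D \<eta> pk ski s (TJoin S) =
    (if tr_key s S \<noteq> None then return_pmf ([], s)
     else do {
       sk \<leftarrow> keygen D \<eta>;
       c \<leftarrow> join_issue D \<eta> pk ski sk;
       return_pmf (enc c, s\<lparr>tr_key := (tr_key s)(S := Some sk), tr_cred := (tr_cred s)(S := c)\<rparr>)
     })"
| "answer_trace D \<eta> pk ski s (TJoinWith S sk) =
    (if tr_key s S \<noteq> None \<or> sk \<notin> set_pmf (keygen D \<eta>) then return_pmf ([], s)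
     else do {
       c \<leftarrow> join_issue D \<eta> pk ski sk;
       return_pmf (enc c, s\<lparr>tr_key := (tr_key s)(S := Some sk), tr_cred := (tr_cred s)(S := c),
         tr_RL := sk # tr_RL s\<rparr>)
     })"
| "answer_trace D \<eta> pk ski s (TCorrupt S) =
    (case tr_key s S of
       None \<Rightarrow> return_pmf ([], s)
     | Some sk \<Rightarrow> return_pmf (enc sk, s\<lparr>tr_RL := sk # tr_RL s\<rparr>))"

definition oracle_trace ::
  "('p1, 'p2, 'ski, 'sk::wire, 'cred::wire, 'n, 'u, 'sig::wire) daa \<Rightarrow> nat
   \<Rightarrow> 'p1 \<times> 'p2 \<Rightarrow> 'ski \<Rightarrow> ('sk, 'cred, 'sig) trace_state challenger"
where
  "oracle_trace D \<eta> pk ski s w =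
    (case parse_trace w of None \<Rightarrow> return_pmf ([], s) | Some x \<Rightarrow> answer_trace D \<eta> pk ski s x)"

definition trace_init :: "('sk, 'cred, 'sig) trace_state" where
  "trace_init = \<lparr>tr_key = (\<lambda>_. None), tr_cred = (\<lambda>_. None), tr_RL = [], tr_log = {}\<rparr>"

text \<open>In the second alternative \<open>\<sigma>\<close> itself has to be a signature associated with \<open>S\<close>. Otherwise
  one could win by attributing a signature obtained from one honest signer to another one. Since a
  \<open>\<sigma>\<close> that is no response to a query wins by the first alternative, it suffices to consider
  responses here.\<close>

definition trace_win ::
  "('p1, 'p2, 'ski, 'sk, 'cred, 'n, 'u, 'sig) daa \<Rightarrow> nat \<Rightarrow> 'p1 \<times> 'p2
   \<Rightarrow> ('sk, 'cred, 'sig) trace_state \<Rightarrow> ident \<times> 'sig \<times> message \<times> basename \<Rightarrow> bool"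
where
  "trace_win D \<eta> pk s = (\<lambda>(S, \<sigma>, m, d).
     verify D \<eta> pk m d \<sigma> (tr_RL s) \<and>
     ((\<forall>S' d' m'. (S', d', m', \<sigma>) \<notin> tr_log s) \<or>
      (d \<noteq> None \<and> (\<exists>m'. (S, d, m', \<sigma>) \<in> tr_log s) \<and>
        (\<exists>m' \<sigma>'. (S, d, m', \<sigma>') \<in> tr_log s \<and> \<sigma>' \<noteq> \<sigma> \<and> \<not> link D \<eta> \<sigma> \<sigma>'))))"

definition trace_game ::
  "('p1::wire, 'p2::wire, 'ski, 'sk::wire, 'cred::wire, 'n, 'u, 'sig::wire) daa
   \<Rightarrow> ('p1, 'p2, 'ski) keydist \<Rightarrow> adversary \<Rightarrow> nat \<Rightarrow> bool pmf"
where
  "trace_game D K A \<eta> = do {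
     (coins, pk, ski) \<leftarrow> K \<eta>;
     (out, s) \<leftarrow> run_adversary A \<eta> (enc (unary \<eta>, pk)) coins (oracle_trace D \<eta> pk ski) trace_init;
     return_pmf (case dec out of Some (x, _) \<Rightarrow> trace_win D \<eta> pk s x | None \<Rightarrow> False)
   }"

definition trace_advantage ::
  "('p1::wire, 'p2::wire, 'ski, 'sk::wire, 'cred::wire, 'n, 'u, 'sig::wire) daa
   \<Rightarrow> ('p1, 'p2, 'ski) keydist \<Rightarrow> adversary \<Rightarrow> nat \<Rightarrow> real"
where
  "trace_advantage D K A \<eta> = pmf (trace_game D K A \<eta>) True"


section \<open>Updateable DAA schemes\<close>

text \<open>A division of the algorithms of a scheme. \<open>setup1\<close> is a deterministic function of coins
  that are uniform in \<open>coin_space\<close>, and \<open>setup2\<close> does not see these coins but only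
  the output of \<open>setup1\<close>. The last argument of \<open>user\<close> is the first message of the issuer.\<close>

record ('coin, 'p1, 'p2, 'ski, 'sk, 'cred, 'n, 'u) division =
  coin_space :: "nat \<Rightarrow> 'coin set"
  setup1 :: "nat \<Rightarrow> 'coin \<Rightarrow> 'p1"
  setup2 :: "nat \<Rightarrow> 'p1 \<Rightarrow> ('p2 \<times> 'ski) pmf"
  user :: "nat \<Rightarrow> 'p1 \<Rightarrow> 'sk \<Rightarrow> 'n \<Rightarrow> 'u pmf"
  issuer :: "nat \<Rightarrow> 'p1 \<times> 'p2 \<Rightarrow> 'u \<Rightarrow> 'ski \<Rightarrow> 'cred option pmf"

definition divides_setup ::
  "('p1, 'p2, 'ski, 'sk, 'cred, 'n, 'u, 'sig) daa
   \<Rightarrow> ('coin, 'p1, 'p2, 'ski, 'sk, 'cred, 'n, 'u) division \<Rightarrow> bool"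
where
  "divides_setup D V \<longleftrightarrow> (\<forall>\<eta>. daa_setup D \<eta> = do {
     r \<leftarrow> pmf_of_set (coin_space V \<eta>);
     (gpk2, ski) \<leftarrow> setup2 V \<eta> (setup1 V \<eta> r);
     return_pmf ((setup1 V \<eta> r, gpk2), ski)
   })"

definition divides_join ::
  "('p1, 'p2, 'ski, 'sk, 'cred, 'n, 'u, 'sig) daa
   \<Rightarrow> ('coin, 'p1, 'p2, 'ski, 'sk, 'cred, 'n, 'u) division \<Rightarrow> bool"
where
  "divides_join D V \<longleftrightarrow>
     (\<forall>\<eta> gpk1 gpk2 sk n. join_signer D \<eta> (gpk1, gpk2) sk n = user V \<eta> gpk1 sk n) \<and>
     (\<forall>\<eta> pk u ski. join_issuer D \<eta> pk u ski = issuer V \<eta> pk u ski)"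

text \<open>The update message does not refer to any \<open>gpk2\<close>, and it yields a valid credential with
  respect to every \<open>gpk2\<close> that is produced with the same \<open>gpk1\<close>.\<close>

definition issues_valid_creds ::
  "('p1, 'p2, 'ski, 'sk, 'cred, 'n, 'u, 'sig) daa
   \<Rightarrow> ('coin, 'p1, 'p2, 'ski, 'sk, 'cred, 'n, 'u) division \<Rightarrow> bool"
where
  "issues_valid_creds D V \<longleftrightarrow>
     (\<forall>\<eta>. \<forall>r \<in> coin_space V \<eta>. \<forall>sk \<in> set_pmf (keygen D \<eta>). \<forall>n \<in> set_pmf (nonce D \<eta>).
       \<forall>u \<in> set_pmf (user V \<eta> (setup1 V \<eta> r) sk n).
       \<forall>(gpk2, ski) \<in> set_pmf (setup2 V \<eta> (setup1 V \<eta> r)).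
       \<forall>c \<in> set_pmf (issuer V \<eta> (setup1 V \<eta> r, gpk2) u ski).
         \<exists>cred. c = Some cred \<and> valid_cred D \<eta> (setup1 V \<eta> r, gpk2) sk cred)"

definition hidden_coins ::
  "('p1, 'p2, 'ski, 'sk, 'cred, 'n, 'u, 'sig) daa \<Rightarrow> ('p1, 'p2, 'ski) keydist"
where
  "hidden_coins D \<eta> = map_pmf (\<lambda>(pk, ski). ([], pk, ski)) (daa_setup D \<eta>)"

definition revealed_coins ::
  "('coin::wire, 'p1, 'p2, 'ski, 'sk, 'cred, 'n, 'u) division \<Rightarrow> ('p1, 'p2, 'ski) keydist"
where
  "revealed_coins V \<eta> = do {
     r \<leftarrow> pmf_of_set (coin_space V \<eta>);
     (gpk2, ski) \<leftarrow> setup2 V \<eta> (setup1 V \<eta> r);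
     return_pmf (enc r, (setup1 V \<eta> r, gpk2), ski)
   }"

definition negligible_increase ::
  "(adversary \<Rightarrow> nat \<Rightarrow> real) \<Rightarrow> (adversary \<Rightarrow> nat \<Rightarrow> real) \<Rightarrow> bool"
where
  "negligible_increase adv adv' \<longleftrightarrow>
     (\<forall>B. \<exists>A \<nu>. negligible \<nu> \<and> (\<forall>\<eta>. adv' B \<eta> \<le> adv A \<eta> + \<nu> \<eta>))"

definition public_coins ::
  "('p1::wire, 'p2::wire, 'ski::wire, 'sk::wire, 'cred::wire, 'n::wire, 'u::wire, 'sig::wire) daa
   \<Rightarrow> ('coin::wire, 'p1, 'p2, 'ski, 'sk, 'cred, 'n, 'u) division \<Rightarrow> bool"
where
  "public_coins D V \<longleftrightarrow>
     (\<forall>\<eta>. finite (coin_space V \<eta>) \<and> coin_space V \<eta> \<noteq> {}) \<and>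
     negligible_increase (anon_advantage D (hidden_coins D)) (anon_advantage D (revealed_coins V)) \<and>
     negligible_increase (trace_advantage D (hidden_coins D)) (trace_advantage D (revealed_coins V))"

definition updateable_daa ::
  "('p1::wire, 'p2::wire, 'ski::wire, 'sk::wire, 'cred::wire, 'n::wire, 'u::wire, 'sig::wire) daa
   \<Rightarrow> ('coin::wire, 'p1, 'p2, 'ski, 'sk, 'cred, 'n, 'u) division \<Rightarrow> bool"
where
  "updateable_daa D V \<longleftrightarrow>
     divides_setup D V \<and> divides_join D V \<and> issues_valid_creds D V \<and> public_coins D V"


section \<open>Brickell and Li's scheme\<close>

type_synonym elem = bitstring

record bl_params =
  ordq :: nat
  G1 :: "elem monoid"
  G2 :: "elem monoid"
  GT :: "elem monoid"
  GJ :: "elem monoid" \<comment> \<open>the group of the pseudonyms\<close>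
  pairing :: "elem \<Rightarrow> elem \<Rightarrow> elem"
  gen1 :: elem
  gen2 :: elem
  hash :: "bool list list \<Rightarrow> nat"
  hash_bsn :: "bitstring \<Rightarrow> elem"
  nonce_len :: nat
  descr :: bitstring \<comment> \<open>published description of the groups, the pairing and the hash functions\<close>

definition bl_setting :: "bl_params \<Rightarrow> bool" where
  "bl_setting P \<longleftrightarrow>
     prime (ordq P) \<and>
     (\<forall>\<G> \<in> {G1 P, G2 P, GT P, GJ P}. comm_group \<G> \<and> order \<G> = ordq P) \<and>
     gen1 P \<in> carrier (G1 P) \<and> generate (G1 P) {gen1 P} = carrier (G1 P) \<and>
     gen2 P \<in> carrier (G2 P) \<and> generate (G2 P) {gen2 P} = carrier (G2 P) \<and>
     (\<forall>a \<in> carrier (G1 P). \<forall>b \<in> carrier (G2 P). pairing P a b \<in> carrier (GT P)) \<and>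
     (\<forall>a \<in> carrier (G1 P). \<forall>a' \<in> carrier (G1 P). \<forall>b \<in> carrier (G2 P).
        pairing P (a \<otimes>\<^bsub>G1 P\<^esub> a') b = pairing P a b \<otimes>\<^bsub>GT P\<^esub> pairing P a' b) \<and>
     (\<forall>a \<in> carrier (G1 P). \<forall>b \<in> carrier (G2 P). \<forall>b' \<in> carrier (G2 P).
        pairing P a (b \<otimes>\<^bsub>G2 P\<^esub> b') = pairing P a b \<otimes>\<^bsub>GT P\<^esub> pairing P a b') \<and>
     pairing P (gen1 P) (gen2 P) \<noteq> \<one>\<^bsub>GT P\<^esub> \<and>
     (\<forall>w. hash P w < ordq P) \<and>
     (\<forall>d. hash_bsn P d \<in> carrier (GJ P))"

type_synonym bl_group = "bitstring \<times> nat \<times> elem \<times> elem"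
type_synonym bl_gpk1 = "bl_group \<times> elem"
type_synonym bl_gpk2 = "elem \<times> elem \<times> elem \<times> elem \<times> elem \<times> elem"
type_synonym bl_pk = "bl_gpk1 \<times> bl_gpk2"
type_synonym bl_cred = "elem \<times> nat"
type_synonym bl_update = "elem \<times> nat \<times> nat \<times> bitstring"
type_synonym bl_sig = "elem \<times> elem \<times> elem \<times> nat \<times> bitstring \<times> nat \<times> nat \<times> nat \<times> nat"

definition bl_group :: "bl_params \<Rightarrow> bl_group" where
  "bl_group P = (descr P, ordq P, gen1 P, gen2 P)"

definition Zq :: "bl_params \<Rightarrow> nat set" where
  "Zq P = {0..<ordq P}"

definition Zq_star :: "bl_params \<Rightarrow> nat set" where
  "Zq_star P = {1..<ordq P}"

definition inv_q :: "bl_params \<Rightarrow> nat \<Rightarrow> nat" where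
  "inv_q P y = nat (modular_inverse (int (ordq P)) (int y))"

definition bl_nonces :: "bl_params \<Rightarrow> bitstring set" where
  "bl_nonces P = Bits ` {bs. length bs = nonce_len P}"

definition bl_setup :: "bl_params \<Rightarrow> (bl_pk \<times> nat) pmf" where
  "bl_setup P = do {
     h1 \<leftarrow> pmf_of_set (carrier (G1 P));
     h2 \<leftarrow> pmf_of_set (carrier (G1 P));
     \<gamma> \<leftarrow> pmf_of_set (Zq_star P);
     let w = gen2 P [^]\<^bsub>G2 P\<^esub> \<gamma>;
     let T1 = pairing P (gen1 P) (gen2 P);
     let T2 = pairing P h1 (gen2 P);
     let T3 = pairing P h2 (gen2 P);
     let T4 = pairing P h2 w;
     return_pmf (((bl_group P, h1), (h2, w, T1, T2, T3, T4)), \<gamma>)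
   }"

text \<open>The argument \<open>pre\<close> yields the part of the hashed tuple that precedes \<open>(nonce, F, R)\<close> in the
  join protocol: \<^term>\<open>enc pk\<close> in the original scheme and nothing in the modified one.\<close>

definition bl_join_signer ::
  "(bl_pk \<Rightarrow> bool list list) \<Rightarrow> bl_params \<Rightarrow> bl_pk \<Rightarrow> nat \<Rightarrow> bitstring \<Rightarrow> bl_update pmf"
where
  "bl_join_signer pre P pk f n = (case pk of ((_, h1), _) \<Rightarrow> do {
     rf \<leftarrow> pmf_of_set (Zq P);
     let F = h1 [^]\<^bsub>G1 P\<^esub> f;
     let R = h1 [^]\<^bsub>G1 P\<^esub> rf;
     let c = hash P (pre pk @ enc (n, F, R));
     return_pmf (F, c, (rf + c * f) mod ordq P, n)
   })"

text \<open>The issuer has to choose \<open>x\<close> such that \<open>1 / (\<gamma> + x)\<close> exists in \<open>\<int>\<^sub>q\<close>.\<close>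

definition bl_join_issuer ::
  "(bl_pk \<Rightarrow> bool list list) \<Rightarrow> bl_params \<Rightarrow> bl_pk \<Rightarrow> bl_update \<Rightarrow> nat \<Rightarrow> bl_cred option pmf"
where
  "bl_join_issuer pre P pk u \<gamma> = (case (pk, u) of (((_, h1), _), (F, c, sf, n)) \<Rightarrow>
     if F \<in> carrier (G1 P) \<and> c \<in> Zq P \<and> sf \<in> Zq P \<and>
        c = hash P (pre pk @
              enc (n, F, h1 [^]\<^bsub>G1 P\<^esub> sf \<otimes>\<^bsub>G1 P\<^esub> inv\<^bsub>G1 P\<^esub> (F [^]\<^bsub>G1 P\<^esub> c)))
     then do {
       x \<leftarrow> pmf_of_set {x \<in> Zq P. \<not> ordq P dvd \<gamma> + x};
       return_pmf (Some ((gen1 P \<otimes>\<^bsub>G1 P\<^esub> F) [^]\<^bsub>G1 P\<^esub> inv_q P (\<gamma> + x), x))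
     }
     else return_pmf None)"

definition bl_valid_cred :: "bl_params \<Rightarrow> bl_pk \<Rightarrow> nat \<Rightarrow> bl_cred \<Rightarrow> bool" where
  "bl_valid_cred P = (\<lambda>((_, h1), (_, w, _)) f (A, x).
     A \<in> carrier (G1 P) \<and> x \<in> Zq P \<and>
     pairing P A (w \<otimes>\<^bsub>G2 P\<^esub> gen2 P [^]\<^bsub>G2 P\<^esub> x) =
       pairing P (gen1 P \<otimes>\<^bsub>G1 P\<^esub> h1 [^]\<^bsub>G1 P\<^esub> f) (gen2 P))"

definition bl_sign ::
  "bl_params \<Rightarrow> bl_pk \<Rightarrow> nat \<Rightarrow> bl_cred \<Rightarrow> basename \<Rightarrow> message \<Rightarrow> bl_sig pmf"
where
  "bl_sign P pk f cred d m = (case (pk, cred) of ((_, (h2, w, T1, T2, T3, T4)), (A, x)) \<Rightarrow> do {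
     J \<leftarrow> (case d of None \<Rightarrow> pmf_of_set (carrier (GJ P)) | Some bsn \<Rightarrow> return_pmf (hash_bsn P bsn));
     let K = J [^]\<^bsub>GJ P\<^esub> f;
     a \<leftarrow> pmf_of_set (Zq P);
     let b = (a * x) mod ordq P;
     let T = A \<otimes>\<^bsub>G1 P\<^esub> h2 [^]\<^bsub>G1 P\<^esub> a;
     rf \<leftarrow> pmf_of_set (Zq P);
     rx \<leftarrow> pmf_of_set (Zq P);
     ra \<leftarrow> pmf_of_set (Zq P);
     rb \<leftarrow> pmf_of_set (Zq P);
     let R1 = J [^]\<^bsub>GJ P\<^esub> rf;
     let R2 = inv\<^bsub>GT P\<^esub> (pairing P T (gen2 P) [^]\<^bsub>GT P\<^esub> rx) \<otimes>\<^bsub>GT P\<^esub> T2 [^]\<^bsub>GT P\<^esub> rf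
                \<otimes>\<^bsub>GT P\<^esub> T3 [^]\<^bsub>GT P\<^esub> rb \<otimes>\<^bsub>GT P\<^esub> T4 [^]\<^bsub>GT P\<^esub> ra;
     n \<leftarrow> pmf_of_set (bl_nonces P);
     let c = hash P (enc ((pk, J, K, T, R1, R2), n, m));
     return_pmf (J, K, T, c, n, (rf + c * f) mod ordq P, (rx + c * x) mod ordq P,
       (ra + c * a) mod ordq P, (rb + c * b) mod ordq P)
   })"

definition bl_verify ::
  "bl_params \<Rightarrow> bl_pk \<Rightarrow> message \<Rightarrow> basename \<Rightarrow> bl_sig \<Rightarrow> nat list \<Rightarrow> bool"
where
  "bl_verify P pk m d \<sigma> RL =
    (case (pk, \<sigma>) of ((_, (h2, w, T1, T2, T3, T4)), (J, K, T, c, n, sf, sx, sa, sb)) \<Rightarrow>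
      let R1 = J [^]\<^bsub>GJ P\<^esub> sf \<otimes>\<^bsub>GJ P\<^esub> inv\<^bsub>GJ P\<^esub> (K [^]\<^bsub>GJ P\<^esub> c);
          R2 = pairing P T (inv\<^bsub>G2 P\<^esub> (gen2 P [^]\<^bsub>G2 P\<^esub> sx) \<otimes>\<^bsub>G2 P\<^esub> inv\<^bsub>G2 P\<^esub> (w [^]\<^bsub>G2 P\<^esub> c))
                \<otimes>\<^bsub>GT P\<^esub> T1 [^]\<^bsub>GT P\<^esub> c \<otimes>\<^bsub>GT P\<^esub> T2 [^]\<^bsub>GT P\<^esub> sf
                \<otimes>\<^bsub>GT P\<^esub> T3 [^]\<^bsub>GT P\<^esub> sb \<otimes>\<^bsub>GT P\<^esub> T4 [^]\<^bsub>GT P\<^esub> sa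
      in J \<in> carrier (GJ P) \<and> K \<in> carrier (GJ P) \<and> T \<in> carrier (G1 P) \<and>
         c \<in> Zq P \<and> n \<in> bl_nonces P \<and> {sf, sx, sa, sb} \<subseteq> Zq P \<and>
         (\<forall>bsn. d = Some bsn \<longrightarrow> J = hash_bsn P bsn) \<and>
         (\<forall>f' \<in> set RL. K \<noteq> J [^]\<^bsub>GJ P\<^esub> f') \<and>
         c = hash P (enc ((pk, J, K, T, R1, R2), n, m)))"

definition bl_link :: "bl_sig \<Rightarrow> bl_sig \<Rightarrow> bool" where
  "bl_link = (\<lambda>(J, K, _) (J', K', _). K = K')"

definition bl_daa ::
  "(bl_pk \<Rightarrow> bool list list) \<Rightarrow> (nat \<Rightarrow> bl_params)
   \<Rightarrow> (bl_gpk1, bl_gpk2, nat, nat, bl_cred, bitstring, bl_update, bl_sig) daa"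
where
  "bl_daa pre pp = \<lparr>
     daa_setup = (\<lambda>\<eta>. bl_setup (pp \<eta>)),
     keygen = (\<lambda>\<eta>. pmf_of_set (Zq_star (pp \<eta>))),
     nonce = (\<lambda>\<eta>. pmf_of_set (bl_nonces (pp \<eta>))),
     join_signer = (\<lambda>\<eta>. bl_join_signer pre (pp \<eta>)),
     join_issuer = (\<lambda>\<eta>. bl_join_issuer pre (pp \<eta>)),
     valid_cred = (\<lambda>\<eta>. bl_valid_cred (pp \<eta>)),
     sign = (\<lambda>\<eta>. bl_sign (pp \<eta>)),
     verify = (\<lambda>\<eta>. bl_verify (pp \<eta>)),
     link = (\<lambda>_. bl_link)\<rparr>"

definition bl_original ::
  "(nat \<Rightarrow> bl_params)
   \<Rightarrow> (bl_gpk1, bl_gpk2, nat, nat, bl_cred, bitstring, bl_update, bl_sig) daa"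
where
  "bl_original = bl_daa enc"

definition bl_modified ::
  "(nat \<Rightarrow> bl_params)
   \<Rightarrow> (bl_gpk1, bl_gpk2, nat, nat, bl_cred, bitstring, bl_update, bl_sig) daa"
where
  "bl_modified = bl_daa (\<lambda>_. [])"


subsection \<open>The division of the modified scheme\<close>

text \<open>The groups are fixed for each security parameter, and \<open>h1\<close> is sampled directly. Hence the
  only coin of the first step of the key generation is the sampled group element.\<close>

definition bl_setup1 :: "bl_params \<Rightarrow> elem \<Rightarrow> bl_gpk1" where
  "bl_setup1 P h1 = (bl_group P, h1)"

definition bl_setup2 :: "bl_params \<Rightarrow> bl_gpk1 \<Rightarrow> (bl_gpk2 \<times> nat) pmf" where
  "bl_setup2 P gpk1 = (case gpk1 of (_, h1) \<Rightarrow> do {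
     h2 \<leftarrow> pmf_of_set (carrier (G1 P));
     \<gamma> \<leftarrow> pmf_of_set (Zq_star P);
     let w = gen2 P [^]\<^bsub>G2 P\<^esub> \<gamma>;
     return_pmf ((h2, w, pairing P (gen1 P) (gen2 P), pairing P h1 (gen2 P),
       pairing P h2 (gen2 P), pairing P h2 w), \<gamma>)
   })"

definition bl_user :: "bl_params \<Rightarrow> bl_gpk1 \<Rightarrow> nat \<Rightarrow> bitstring \<Rightarrow> bl_update pmf" where
  "bl_user P gpk1 f n = (case gpk1 of (_, h1) \<Rightarrow> do {
     rf \<leftarrow> pmf_of_set (Zq P);
     let F = h1 [^]\<^bsub>G1 P\<^esub> f;
     let c = hash P (enc (n, F, h1 [^]\<^bsub>G1 P\<^esub> rf));
     return_pmf (F, c, (rf + c * f) mod ordq P, n)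
   })"

definition bl_division ::
  "(nat \<Rightarrow> bl_params)
   \<Rightarrow> (elem, bl_gpk1, bl_gpk2, nat, nat, bl_cred, bitstring, bl_update) division"
where
  "bl_division pp = \<lparr>
     coin_space = (\<lambda>\<eta>. carrier (G1 (pp \<eta>))),
     setup1 = (\<lambda>\<eta>. bl_setup1 (pp \<eta>)),
     setup2 = (\<lambda>\<eta>. bl_setup2 (pp \<eta>)),
     user = (\<lambda>\<eta>. bl_user (pp \<eta>)),
     issuer = (\<lambda>\<eta>. bl_join_issuer (\<lambda>_. []) (pp \<eta>))\<rparr>"

end

theory Submission
  imports Defs "HOL-Algebra.Multiplicative_Group"
begin

text \<open>An adversary against the scheme with revealed coins is simulated exactly by one that gets no
  coins: the only coin is the group element \<open>h1\<close>, which is part of the public key, so that two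
  additional instructions copy it into the register where the coin is expected. An update message
  depends only on \<open>h1\<close>, and the issuer's exponent \<open>1 / (\<gamma> + x)\<close> cancels in the pairing equation
  for whichever \<open>\<gamma>\<close> is used.\<close>

text \<open>The bound grows by 2 because \<open>Seq\<close> and \<open>Copy\<close> cost one unit
  each, which leaves \<open>B\<close> exactly its own time.\<close>

definition copy_coin :: "nat \<Rightarrow> adversary \<Rightarrow> adversary" where
  "copy_coin i B = (Seq (Copy (In i) (Coin 0)) (fst B), snd B + [:2:])"

text \<open>Whole memories agree because \<open>fetch\<close> returns \<open>[]\<close> beyond the
  end of a tuple: the registers \<open>Coin k\<close> with \<open>k > 0\<close> are empty on both
  sides.\<close>

lemma init_mem_copy_coin:
  assumes "fetch w i = c"
  shows "(init_mem w [])(Coin 0 := init_mem w [] (In i)) = init_mem w [c]"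
  using assms by (auto simp: init_mem_def fetch_def fun_eq_iff split: reg.split)

lemma run_adversary_copy_coin:
  assumes "fetch w i = c"
  shows "run_adversary (copy_coin i B) \<eta> w [] C s = run_adversary B \<eta> w [c] C s"
proof -
  \<comment> \<open>\<open>run\<close> recurses on \<open>Suc\<close>, so this form of the clock
    lets \<open>Seq\<close> and \<open>Copy\<close> be executed symbolically.\<close>
  have "poly (snd B + [:2:]) \<eta> = Suc (Suc (poly (snd B) \<eta>))"
    by simp
  then show ?thesis
    by (simp add: run_adversary_def copy_coin_def init_mem_copy_coin[OF assms] del: poly_add)
qed

lemma negligible_increase_if_eq:
  assumes "\<And>B \<eta>. adv' B \<eta> = adv (f B) \<eta>"
  shows "negligible_increase adv adv'"
  unfolding negligible_increase_def
proof
  fix B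
  have "negligible (\<lambda>_. 0)"
    by (simp add: negligible_def)
  then show "\<exists>A \<nu>. negligible \<nu> \<and> (\<forall>\<eta>. adv' B \<eta> \<le> adv A \<eta> + \<nu> \<eta>)"
    using assms by (intro exI[of _ "f B"] exI[of _ "\<lambda>_. 0"]) simp
qed

text \<open>Puts both experiments over the same sampling of \<open>r\<close>, so that they can be
  compared for each coin separately.\<close>

lemma hidden_coins_if_divides_setup:
  assumes "divides_setup D V"
  shows "hidden_coins D \<eta> = map_pmf (\<lambda>(_, pk, ski). ([], pk, ski)) (revealed_coins V \<eta>)"
  using assms by (simp add: divides_setup_def hidden_coins_def revealed_coins_def map_bind_pmf
      case_prod_unfold)

text \<open>The register \<open>In i\<close> or \<open>In j\<close> already holds the coin, so
  \<open>copy_coin\<close> reproduces each run of \<open>B\<close> exactly and the advantages are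
  equal, not just close. There are two indices because the input of the anonymity experiment also
  contains \<open>ski\<close>.\<close>

lemma public_coins_if_coin_in_gpk1:
  fixes D :: "('p1::wire, 'p2::wire, 'ski::wire, 'sk::wire, 'cred::wire, 'n::wire, 'u::wire,
      'sig::wire) daa"
    and V :: "(elem, 'p1, 'p2, 'ski, 'sk, 'cred, 'n, 'u) division"
  assumes "\<And>\<eta>. finite (coin_space V \<eta>)" "\<And>\<eta>. coin_space V \<eta> \<noteq> {}"
    and div: "divides_setup D V"
    and anon: "\<And>\<eta> r gpk2 ski. fetch (enc (unary \<eta>, ski :: 'ski, setup1 V \<eta> r, gpk2 :: 'p2)) i = unbits r"
    and trace: "\<And>\<eta> r gpk2. fetch (enc (unary \<eta>, setup1 V \<eta> r, gpk2 :: 'p2)) j = unbits r"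
  shows "public_coins D V"
proof -
  have "anon_advantage D (revealed_coins V) B \<eta> = anon_advantage D (hidden_coins D) (copy_coin i B) \<eta>"
    for B \<eta>
    by (simp add: anon_advantage_def anon_game_def hidden_coins_if_divides_setup[OF div]
        revealed_coins_def map_bind_pmf bind_map_pmf bind_assoc_pmf bind_return_pmf
        case_prod_unfold enc_bitstring_def run_adversary_copy_coin[OF anon])
  moreover have "trace_advantage D (revealed_coins V) B \<eta> =
      trace_advantage D (hidden_coins D) (copy_coin j B) \<eta>" for B \<eta>
    by (simp add: trace_advantage_def trace_game_def hidden_coins_if_divides_setup[OF div]
        revealed_coins_def map_bind_pmf bind_map_pmf bind_assoc_pmf bind_return_pmf
        case_prod_unfold enc_bitstring_def run_adversary_copy_coin[OF trace] cong: option.case_cong)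
  ultimately show ?thesis
    using assms(1,2) by (auto simp: public_coins_def intro: negligible_increase_if_eq)
qed

lemma (in group) nat_pow_mod_order:
  fixes n :: nat
  assumes "a \<in> carrier G"
  shows "a [^] (n mod order G) = a [^] n"
proof -
  have "a [^] n = a [^] (order G * (n div order G) + n mod order G)"
    by simp
  also have "\<dots> = (a [^] order G) [^] (n div order G) \<otimes> a [^] (n mod order G)"
    using assms by (simp add: nat_pow_mult nat_pow_pow del: mult_div_mod_eq)
  finally show ?thesis
    using assms by (simp add: pow_order_eq_1)
qed

lemma inv_q_mult_mod:
  assumes "prime (ordq P)" "\<not> ordq P dvd y"
  shows "(inv_q P y * y) mod ordq P = 1"
proof -
  have "coprime (int (ordq P)) (int y)"
    using assms by (simp add: prime_imp_coprime)
  \<comment> \<open>The modular inverse is nonnegative, so the conversion to \<open>nat\<close> in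
    \<open>inv_q\<close> loses nothing and the congruence transfers from the integers.\<close>
  then have "[int (inv_q P y * y) = int 1] (mod int (ordq P))"
    using cong_modular_inverse2[of "int y" "int (ordq P)"] prime_gt_0_nat[OF assms(1)]
    by (simp add: inv_q_def modular_inverse_int_nonneg coprime_commute)
  then have "[inv_q P y * y = 1] (mod ordq P)"
    by (simp only: cong_int_iff)
  then show ?thesis
    using prime_gt_1_nat[OF assms(1)] by (simp add: cong_def)
qed

locale bl =
  fixes P :: bl_params
  assumes setting: "bl_setting P"
begin

lemma prime_q: "prime (ordq P)"
  using setting by (simp add: bl_setting_def)

sublocale G1: comm_group "G1 P"
  using setting by (simp add: bl_setting_def)

sublocale G2: comm_group "G2 P"
  using setting by (simp add: bl_setting_def)

sublocale GT: comm_group "GT P"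
  using setting by (simp add: bl_setting_def)

lemma order_G1: "order (G1 P) = ordq P"
  using setting by (simp add: bl_setting_def)

text \<open>An infinite carrier would have \<open>order\<close> 0, but \<open>ordq P\<close> is
  prime.\<close>

lemma finite_G1: "finite (carrier (G1 P))"
  using order_G1 prime_gt_0_nat[OF prime_q] by (metis G1.order_gt_0_iff_finite)

lemma gen1_closed: "gen1 P \<in> carrier (G1 P)" and gen2_closed: "gen2 P \<in> carrier (G2 P)"
  using setting by (simp_all add: bl_setting_def)

lemma pairing_closed:
  "a \<in> carrier (G1 P) \<Longrightarrow> b \<in> carrier (G2 P) \<Longrightarrow> pairing P a b \<in> carrier (GT P)"
  using setting by (simp add: bl_setting_def)

lemma pairing_mult_left:
  "a \<in> carrier (G1 P) \<Longrightarrow> a' \<in> carrier (G1 P) \<Longrightarrow> b \<in> carrier (G2 P) \<Longrightarrow>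
    pairing P (a \<otimes>\<^bsub>G1 P\<^esub> a') b = pairing P a b \<otimes>\<^bsub>GT P\<^esub> pairing P a' b"
  using setting by (simp add: bl_setting_def)

lemma pairing_mult_right:
  "a \<in> carrier (G1 P) \<Longrightarrow> b \<in> carrier (G2 P) \<Longrightarrow> b' \<in> carrier (G2 P) \<Longrightarrow>
    pairing P a (b \<otimes>\<^bsub>G2 P\<^esub> b') = pairing P a b \<otimes>\<^bsub>GT P\<^esub> pairing P a b'"
  using setting by (simp add: bl_setting_def)

lemma pairing_pow_left:
  fixes n :: nat
  assumes "a \<in> carrier (G1 P)" "b \<in> carrier (G2 P)"
  shows "pairing P (a [^]\<^bsub>G1 P\<^esub> n) b = pairing P a b [^]\<^bsub>GT P\<^esub> n"
proof -
  have "(\<lambda>a. pairing P a b) \<in> hom (G1 P) (GT P)"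
    using assms by (auto simp: hom_def pairing_closed pairing_mult_left)
  then interpret group_hom "G1 P" "GT P" "\<lambda>a. pairing P a b"
    by unfold_locales
  show ?thesis
    using assms by (simp add: hom_nat_pow)
qed

lemma pairing_pow_right:
  fixes n :: nat
  assumes "a \<in> carrier (G1 P)" "b \<in> carrier (G2 P)"
  shows "pairing P a (b [^]\<^bsub>G2 P\<^esub> n) = pairing P a b [^]\<^bsub>GT P\<^esub> n"
proof -
  have "pairing P a \<in> hom (G2 P) (GT P)"
    using assms by (auto simp: hom_def pairing_closed pairing_mult_right)
  then interpret group_hom "G2 P" "GT P" "pairing P a"
    by unfold_locales
  show ?thesis
    using assms by (simp add: hom_nat_pow)
qed

lemma finite_Zq: "finite (Zq P)" and Zq_nonempty: "Zq P \<noteq> {}"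
  and finite_Zq_star: "finite (Zq_star P)" and Zq_star_nonempty: "Zq_star P \<noteq> {}"
  using prime_gt_1_nat[OF prime_q] by (auto simp: Zq_def Zq_star_def)

text \<open>Completeness of the Schnorr proof: the left side is what the issuer recomputes from the
  response and hashes in place of the signer's commitment.\<close>

lemma schnorr_commitment:
  fixes rf c f :: nat
  assumes "h1 \<in> carrier (G1 P)"
  shows "h1 [^]\<^bsub>G1 P\<^esub> ((rf + c * f) mod ordq P) \<otimes>\<^bsub>G1 P\<^esub>
      inv\<^bsub>G1 P\<^esub> ((h1 [^]\<^bsub>G1 P\<^esub> f) [^]\<^bsub>G1 P\<^esub> c) = h1 [^]\<^bsub>G1 P\<^esub> rf"
proof -
  have "h1 [^]\<^bsub>G1 P\<^esub> ((rf + c * f) mod ordq P) =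
      h1 [^]\<^bsub>G1 P\<^esub> rf \<otimes>\<^bsub>G1 P\<^esub> (h1 [^]\<^bsub>G1 P\<^esub> f) [^]\<^bsub>G1 P\<^esub> c"
    using assms G1.nat_pow_mod_order[OF assms]
    by (simp add: order_G1 G1.nat_pow_pow G1.nat_pow_mult mult.commute)
  then show ?thesis
    using assms by (simp add: G1.m_assoc)
qed

lemma valid_cred_issued:
  assumes "h1 \<in> carrier (G1 P)" "x \<in> Zq P" "\<not> ordq P dvd \<gamma> + x"
  shows "bl_valid_cred P ((grp, h1), (h2, gen2 P [^]\<^bsub>G2 P\<^esub> \<gamma>, Ts)) f
    ((gen1 P \<otimes>\<^bsub>G1 P\<^esub> h1 [^]\<^bsub>G1 P\<^esub> f) [^]\<^bsub>G1 P\<^esub> inv_q P (\<gamma> + x), x)"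
proof -
  let ?B = "gen1 P \<otimes>\<^bsub>G1 P\<^esub> h1 [^]\<^bsub>G1 P\<^esub> f"
  let ?A = "?B [^]\<^bsub>G1 P\<^esub> inv_q P (\<gamma> + x)"
  have B: "?B \<in> carrier (G1 P)"
    using assms gen1_closed by simp
  \<comment> \<open>Bilinearity moves the exponent \<open>\<gamma> + x\<close> from
    \<open>gen2 P\<close> over to \<open>?A\<close>.\<close>
  have "pairing P ?A (gen2 P [^]\<^bsub>G2 P\<^esub> \<gamma> \<otimes>\<^bsub>G2 P\<^esub> gen2 P [^]\<^bsub>G2 P\<^esub> x) =
      pairing P (?A [^]\<^bsub>G1 P\<^esub> (\<gamma> + x)) (gen2 P)"
    using B gen2_closed by (simp add: G2.nat_pow_mult pairing_pow_left pairing_pow_right)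
  \<comment> \<open>Exponents in \<open>G1 P\<close> count modulo its order \<open>ordq P\<close>,
    so the product with the inverse becomes 1.\<close>
  also have "?A [^]\<^bsub>G1 P\<^esub> (\<gamma> + x) = ?B [^]\<^bsub>G1 P\<^esub> ((inv_q P (\<gamma> + x) * (\<gamma> + x)) mod ordq P)"
    using B G1.nat_pow_mod_order[OF B] by (simp only: G1.nat_pow_pow order_G1)
  also have "\<dots> = ?B"
    using B by (simp add: inv_q_mult_mod[OF prime_q assms(3)] del: G1.m_closed)
  finally show ?thesis
    using assms B by (simp add: bl_valid_cred_def)
qed

text \<open>Signer and issuer hash the same tuple, with empty prefix, so the check accepts whichever
  \<open>gpk2\<close> is used, and \<open>valid_cred_issued\<close> applies.\<close>

lemma issuer_valid_cred:
  assumes "h1 \<in> carrier (G1 P)"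
    and u: "u \<in> set_pmf (bl_user P (bl_setup1 P h1) f n)"
    and key: "(gpk2, \<gamma>) \<in> set_pmf (bl_setup2 P (bl_setup1 P h1))"
    and c: "c \<in> set_pmf (bl_join_issuer (\<lambda>_. []) P (bl_setup1 P h1, gpk2) u \<gamma>)"
  shows "\<exists>cred. c = Some cred \<and> bl_valid_cred P (bl_setup1 P h1, gpk2) f cred"
proof -
  let ?X = "{x \<in> Zq P. \<not> ordq P dvd \<gamma> + x}"
  obtain h2 Ts where \<gamma>: "\<gamma> \<in> Zq_star P" and gpk2: "gpk2 = (h2, gen2 P [^]\<^bsub>G2 P\<^esub> \<gamma>, Ts)"
    using key finite_G1 G1.carrier_not_empty finite_Zq_star Zq_star_nonempty
    by (auto simp: bl_setup2_def bl_setup1_def Let_def)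
  \<comment> \<open>Since \<open>0 < \<gamma> < ordq P\<close>, the choice \<open>x = 0\<close> is
    admissible. Nonemptiness is needed for \<open>pmf_of_set ?X\<close> to have support
    \<open>?X\<close>.\<close>
  have "0 \<in> ?X"
    using \<gamma> by (auto simp: Zq_def Zq_star_def dest: nat_dvd_not_less)
  then have X: "?X \<noteq> {}" "finite ?X"
    using finite_Zq by auto
  \<comment> \<open>The challenge and the response pass the issuer's range checks.\<close>
  have "hash P w \<in> Zq P" for w
    using setting by (simp add: bl_setting_def Zq_def)
  moreover have "r mod ordq P \<in> Zq P" for r
    using prime_gt_0_nat[OF prime_q] by (simp add: Zq_def)
  ultimately show ?thesis
    using u c assms(1) finite_Zq Zq_nonempty
    by (auto simp: gpk2 set_pmf_of_set[OF X] bl_user_def bl_setup1_def bl_join_issuer_def schnorr_commitment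
        valid_cred_issued Let_def split: if_splits)
qed

end

theorem theorem7:
  fixes pp :: "nat \<Rightarrow> bl_params"
  assumes "\<And>\<eta>. bl_setting (pp \<eta>)"
  shows "updateable_daa (bl_modified pp) (bl_division pp)"
proof -
  have bl: "bl (pp \<eta>)" for \<eta>
    using assms by unfold_locales
  have carrier: "finite (carrier (G1 (pp \<eta>)))" "carrier (G1 (pp \<eta>)) \<noteq> {}" for \<eta>
  proof -
    interpret bl "pp \<eta>" by (rule bl)
    show "finite (carrier (G1 (pp \<eta>)))" "carrier (G1 (pp \<eta>)) \<noteq> {}"
      using finite_G1 G1.carrier_not_empty by auto
  qed
  have div: "divides_setup (bl_modified pp) (bl_division pp)"
    by (simp add: divides_setup_def bl_modified_def bl_daa_def bl_division_def bl_setup_def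
        bl_setup1_def bl_setup2_def Let_def bind_assoc_pmf bind_return_pmf)
  \<comment> \<open>With the empty prefix the challenge is computed from the nonce and powers of
    \<open>h1\<close>, so the signer's step needs no \<open>gpk2\<close>.\<close>
  moreover have "divides_join (bl_modified pp) (bl_division pp)"
    by (simp add: divides_join_def bl_modified_def bl_daa_def bl_division_def bl_join_signer_def
        bl_user_def Let_def split: prod.split)
  moreover have "issues_valid_creds (bl_modified pp) (bl_division pp)"
    using bl.issuer_valid_cred[OF bl]
    by (fastforce simp: issues_valid_creds_def bl_modified_def bl_daa_def bl_division_def)
  moreover have "public_coins (bl_modified pp) (bl_division pp)"
    \<comment> \<open>The keys are preceded by the unary security parameter and, in the anonymity experiment, by
      the issuer's key; within them, \<open>h1\<close> follows the four components of the group description.\<close>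
    using carrier div
    by (intro public_coins_if_coin_in_gpk1[where i = 6 and j = 5])
      (simp_all add: bl_division_def bl_setup1_def bl_group_def fetch_def enc_prod_def
        enc_bitstring_def enc_nat_def)
  ultimately show ?thesis
    by (simp add: updateable_daa_def)
qed

end
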